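(* Let $X$ be a complex Banach space. The set of contractions on $X$ of class (H), the set of contractions on $X$ of class (S), and the set of contractions on $X$ of class (D) are multiplicative semigroups (each is closed under products of operators). In addition, the sets of contractions of class (S) and of class (D) are convex.
   Context: A contraction on $X$ is a bounded linear operator $T$ on $X$ with $\|T\|\le 1$. The classes are defined as follows. (H): there is $K\ge 0$ such that $\|x-Tx\|^2\le K(\|x\|^2-\|Tx\|^2)$ for all $x\in X$. (S): for every sequence $(x_k)$ in $X$ with $\|x_k\|\le 1$ and $\|Tx_k\|\to 1$, one has $\|x_k-Tx_k\|\to 0$ (this holds vacuously if $\|T\|<1$). (D): there is $r\in(0,1)$ such that $\|T-rI\|\le 1-r$, where $I$ is the identity operator. *)

theory Defs
  imports "HOL-Analysis.Analysis"
begin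

text \<open>
  The library's class \<open>banach\<close> is real. A complex Banach space is a real one whose real scalar
  multiplication is the restriction of a complex one, with the norm homogeneous over the
  complex numbers.
\<close>

class complex_banach = banach +
  fixes scaleC :: "complex \<Rightarrow> 'a \<Rightarrow> 'a"  (infixr "*\<^sub>C" 75)
  assumes scaleC_add_right: "c *\<^sub>C (x + y) = c *\<^sub>C x + c *\<^sub>C y"
    and scaleC_add_left: "(c + d) *\<^sub>C x = c *\<^sub>C x + d *\<^sub>C x"
    and scaleC_scaleC: "c *\<^sub>C d *\<^sub>C x = (c * d) *\<^sub>C x"
    and scaleC_one: "1 *\<^sub>C x = x"
    and scaleR_eq_scaleC: "r *\<^sub>R x = complex_of_real r *\<^sub>C x"
    and norm_scaleC: "norm (c *\<^sub>C x) = cmod c * norm x"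

lemma vector_space_scaleC:
  "vector_space (scaleC :: complex \<Rightarrow> 'a::complex_banach \<Rightarrow> 'a)"
  by (unfold_locales)
    (simp_all add: scaleC_add_right scaleC_add_left scaleC_scaleC scaleC_one)

text \<open>
  An element of type \<open>'a \<Rightarrow>\<^sub>L 'a\<close> is only real-linear, so complex linearity is required
  separately; the norm of this type is the operator norm.
\<close>

definition contractions :: "('a::complex_banach \<Rightarrow>\<^sub>L 'a) set" where
  "contractions =
     {T. Vector_Spaces.linear scaleC scaleC (blinfun_apply T) \<and> norm T \<le> 1}"

definition class_H :: "('a::complex_banach \<Rightarrow>\<^sub>L 'a) set" where
  "class_H = {T \<in> contractions.
     \<exists>K::real. K \<ge> 0 \<and>
       (\<forall>x. (norm (x - blinfun_apply T x))\<^sup>2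
              \<le> K * ((norm x)\<^sup>2 - (norm (blinfun_apply T x))\<^sup>2))}"

definition class_S :: "('a::complex_banach \<Rightarrow>\<^sub>L 'a) set" where
  "class_S = {T \<in> contractions.
     \<forall>x :: nat \<Rightarrow> 'a.
       (\<forall>k. norm (x k) \<le> 1) \<longrightarrow>
       (\<lambda>k. norm (blinfun_apply T (x k))) \<longlonglongrightarrow> 1 \<longrightarrow>
       (\<lambda>k. norm (x k - blinfun_apply T (x k))) \<longlonglongrightarrow> 0}"

definition class_D :: "('a::complex_banach \<Rightarrow>\<^sub>L 'a) set" where
  "class_D = {T \<in> contractions.
     \<exists>r::real. 0 < r \<and> r < 1 \<and> norm (T - r *\<^sub>R id_blinfun) \<le> 1 - r}"

text \<open>
  Composition of operators is associative on the whole type, so being a multiplicative semigroup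
  amounts to closure under products.
\<close>

lemma blinfun_compose_assoc: "(R o\<^sub>L S) o\<^sub>L T = R o\<^sub>L (S o\<^sub>L T)"
  by (rule blinfun_eqI) simp

definition multiplicative_semigroup :: "('a::complex_banach \<Rightarrow>\<^sub>L 'a) set \<Rightarrow> bool" where
  "multiplicative_semigroup C \<longleftrightarrow> (\<forall>S\<in>C. \<forall>T\<in>C. S o\<^sub>L T \<in> C)"

end

theory Submission
  imports Defs
begin

text \<open>
  Classes (H) and (S) say, with and without a rate, that a contraction hardly moves a vector that
  it hardly shrinks; class (D) is a condition on the position of the operator in operator norm. Every
  closure property comes from the triangle inequality.

  For a product, \<open>x - S T x = (x - T x) + (T x - S (T x))\<close>, so the displacement of \<open>S T\<close> at \<open>x\<close> is
  controlled by those of \<open>T\<close> at \<open>x\<close> and of \<open>S\<close> at \<open>T x\<close>. Since \<open>\<parallel>S T x\<parallel> \<le> \<parallel>T x\<parallel> \<le> \<parallel>x\<parallel>\<close>, the norm,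
  or its square, lost along \<open>S T\<close> is the sum of the nonnegative losses in the two steps. In class (H) this
  telescopes, after \<open>(a + b)\<^sup>2 \<le> 2 a\<^sup>2 + 2 b\<^sup>2\<close>; in class (S) it says that a sequence which loses
  asymptotically nothing under \<open>S T\<close> loses asymptotically nothing in either step. A convex
  combination \<open>u S + v T\<close> with \<open>u, v > 0\<close> behaves alike in class (S), because an average, with fixed
  positive weights, of sequences bounded by 1 can tend to 1 only if each of them does.

  Class (D) says that \<open>T\<close> lies in the ball of radius \<open>1 - r\<close> about \<open>r I\<close> for some \<open>r\<close> strictly between 0 and 1.
  The radius is affine in \<open>r\<close>, so parameters average under convex combinations; and the splitting
  \<open>S T - r s I = (S - r I) T + r (T - s I)\<close> shows that they multiply under products, as
  \<open>(1 - r) + r (1 - s) = 1 - r s\<close>.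
\<close>

section \<open>Contractions\<close>

lemma contractions_norm_apply_le:
  assumes "T \<in> contractions"
  shows "norm (blinfun_apply T x) \<le> norm x"
proof -
  have "norm (blinfun_apply T x) \<le> norm T * norm x"
    by (rule norm_blinfun)
  also have "\<dots> \<le> 1 * norm x"
    using assms by (intro mult_right_mono) (auto simp: contractions_def)
  finally show ?thesis
    by simp
qed

lemma contractions_compose:
  assumes "S \<in> contractions" and "T \<in> contractions"
  shows "S o\<^sub>L T \<in> contractions"
proof -
  have "Vector_Spaces.linear scaleC scaleC (blinfun_apply S \<circ> blinfun_apply T)"
    using assms by (auto simp: contractions_def intro: Vector_Spaces.linear_compose)
  moreover have "blinfun_apply (S o\<^sub>L T) = blinfun_apply S \<circ> blinfun_apply T"
    by (simp add: fun_eq_iff)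
  moreover have "norm (S o\<^sub>L T) \<le> 1"
  proof -
    have "norm (S o\<^sub>L T) \<le> norm S * norm T"
      by (rule norm_blinfun_compose)
    also have "\<dots> \<le> 1"
      using assms by (auto simp: contractions_def intro: mult_le_one)
    finally show ?thesis .
  qed
  ultimately show ?thesis
    by (simp add: contractions_def)
qed

lemma scaleR_scaleC_commute: "r *\<^sub>R c *\<^sub>C x = c *\<^sub>C r *\<^sub>R (x :: 'a::complex_banach)"
  by (simp add: scaleR_eq_scaleC scaleC_scaleC mult.commute)

lemma convex_contractions: "convex (contractions :: ('a::complex_banach \<Rightarrow>\<^sub>L 'a) set)"
proof (rule convexI)
  fix S T :: "'a \<Rightarrow>\<^sub>L 'a" and u v :: real
  assume S: "S \<in> contractions" and T: "T \<in> contractions"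
    and uv: "0 \<le> u" "0 \<le> v" "u + v = 1"
  have hom: "blinfun_apply S (c *\<^sub>C x) = c *\<^sub>C blinfun_apply S x"
    "blinfun_apply T (c *\<^sub>C x) = c *\<^sub>C blinfun_apply T x" for c x
    using S T by (auto simp: contractions_def Vector_Spaces.linear_iff)
  have "Vector_Spaces.linear scaleC scaleC (blinfun_apply (u *\<^sub>R S + v *\<^sub>R T))"
    unfolding Vector_Spaces.linear_iff
    by (simp add: vector_space_scaleC blinfun.bilinear_simps hom scaleR_scaleC_commute scaleC_add_right)
  moreover have "norm (u *\<^sub>R S + v *\<^sub>R T) \<le> 1"
    using convexD[OF convex_cball, of S 0 1 T u v] S T uv by (simp add: contractions_def)
  ultimately show "u *\<^sub>R S + v *\<^sub>R T \<in> contractions"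
    by (simp add: contractions_def)
qed

section \<open>Class (H)\<close>

lemma class_H_compose:
  assumes S: "S \<in> class_H" and T: "T \<in> class_H"
  shows "S o\<^sub>L T \<in> class_H"
proof -
  obtain K L where "K \<ge> 0" "L \<ge> 0"
    and K: "\<And>x. (norm (x - blinfun_apply S x))\<^sup>2 \<le> K * ((norm x)\<^sup>2 - (norm (blinfun_apply S x))\<^sup>2)"
    and L: "\<And>x. (norm (x - blinfun_apply T x))\<^sup>2 \<le> L * ((norm x)\<^sup>2 - (norm (blinfun_apply T x))\<^sup>2)"
    using S T unfolding class_H_def by blast
  have cS: "S \<in> contractions" and cT: "T \<in> contractions"
    using S T by (auto simp: class_H_def)
  define M where "M = max K L"
  have "(norm (x - blinfun_apply S (blinfun_apply T x)))\<^sup>2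
      \<le> 2 * M * ((norm x)\<^sup>2 - (norm (blinfun_apply S (blinfun_apply T x)))\<^sup>2)" for x
  proof -
    define y where "y = blinfun_apply T x"
    define z where "z = blinfun_apply S y"
    have "norm y \<le> norm x" "norm z \<le> norm y"
      using contractions_norm_apply_le cS cT by (auto simp: y_def z_def)
    then have loss: "(norm y)\<^sup>2 \<le> (norm x)\<^sup>2" "(norm z)\<^sup>2 \<le> (norm y)\<^sup>2"
      by (auto intro: power_mono)
    have "norm (x - z) \<le> norm (x - y) + norm (y - z)"
      using norm_triangle_ineq[of "x - y" "y - z"] by simp
    then have "(norm (x - z))\<^sup>2 \<le> (norm (x - y) + norm (y - z))\<^sup>2"
      by (intro power_mono) auto
    also have "\<dots> \<le> 2 * (norm (x - y))\<^sup>2 + 2 * (norm (y - z))\<^sup>2"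
      using sum_squares_bound[of "norm (x - y)" "norm (y - z)"] by (simp add: power2_sum)
    also have "\<dots> \<le> 2 * (L * ((norm x)\<^sup>2 - (norm y)\<^sup>2)) + 2 * (K * ((norm y)\<^sup>2 - (norm z)\<^sup>2))"
      using K[of y] L[of x] by (simp add: y_def z_def)
    also have "\<dots> \<le> 2 * (M * ((norm x)\<^sup>2 - (norm y)\<^sup>2)) + 2 * (M * ((norm y)\<^sup>2 - (norm z)\<^sup>2))"
      using loss by (intro add_mono mult_left_mono mult_right_mono) (auto simp: M_def)
    also have "\<dots> = 2 * M * ((norm x)\<^sup>2 - (norm z)\<^sup>2)"
      by (simp add: algebra_simps)
    finally show ?thesis
      by (simp add: y_def z_def)
  qed
  moreover have "2 * M \<ge> 0"
    using \<open>K \<ge> 0\<close> by (simp add: M_def)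
  ultimately show ?thesis
    using contractions_compose[OF cS cT] unfolding class_H_def
    by (auto intro!: exI[of _ "2 * M"])
qed

section \<open>Class (S)\<close>

lemma class_S_D:
  assumes "T \<in> class_S" and "\<And>k. norm (x k) \<le> 1"
    and "(\<lambda>k. norm (blinfun_apply T (x k))) \<longlonglongrightarrow> 1"
  shows "(\<lambda>k. x k - blinfun_apply T (x k)) \<longlonglongrightarrow> 0"
  using assms unfolding class_S_def by (auto simp: tendsto_norm_zero_iff)

lemma class_S_compose:
  assumes S: "S \<in> class_S" and T: "T \<in> class_S"
  shows "S o\<^sub>L T \<in> class_S"
proof -
  have cS: "S \<in> contractions" and cT: "T \<in> contractions"
    using S T by (auto simp: class_S_def)
  have "(\<lambda>k. norm (x k - blinfun_apply S (blinfun_apply T (x k)))) \<longlonglongrightarrow> 0"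
    if x: "\<And>k. norm (x k) \<le> 1"
      and lim: "(\<lambda>k. norm (blinfun_apply S (blinfun_apply T (x k)))) \<longlonglongrightarrow> 1" for x
  proof -
    have le1: "norm (blinfun_apply T (x k)) \<le> 1" for k
      using contractions_norm_apply_le[OF cT, of "x k"] x[of k] by linarith
    have "(\<lambda>k. norm (blinfun_apply T (x k))) \<longlonglongrightarrow> 1"
      by (rule tendsto_sandwich[OF _ _ lim tendsto_const])
        (auto simp: le1 contractions_norm_apply_le[OF cS])
    then have "(\<lambda>k. x k - blinfun_apply T (x k)) \<longlonglongrightarrow> 0"
      by (rule class_S_D[OF T x])
    moreover have "(\<lambda>k. blinfun_apply T (x k) - blinfun_apply S (blinfun_apply T (x k))) \<longlonglongrightarrow> 0"
      by (rule class_S_D[OF S le1 lim])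
    ultimately have "(\<lambda>k. (x k - blinfun_apply T (x k))
        + (blinfun_apply T (x k) - blinfun_apply S (blinfun_apply T (x k)))) \<longlonglongrightarrow> 0 + 0"
      by (rule tendsto_add)
    then show ?thesis
      by (simp add: tendsto_norm_zero_iff)
  qed
  then show ?thesis
    using contractions_compose[OF cS cT] by (simp add: class_S_def)
qed

text \<open>
  The lower bound \<open>a k \<ge> (c k - v) / u\<close> squeezes \<open>a\<close> towards its upper bound, since \<open>1 - v = u\<close>.
\<close>

lemma tendsto_1_of_average:
  fixes a b c :: "nat \<Rightarrow> real"
  assumes "0 < u" "0 \<le> v" "u + v = 1"
    and a: "\<And>k. a k \<le> 1" and b: "\<And>k. b k \<le> 1"
    and c: "\<And>k. c k \<le> u * a k + v * b k" "c \<longlonglongrightarrow> 1"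
  shows "a \<longlonglongrightarrow> 1"
proof (rule tendsto_sandwich[OF _ _ _ tendsto_const])
  have "(c k - v) / u \<le> a k" for k
  proof -
    have "v * b k \<le> v"
      using b[of k] assms(2) by (simp add: mult_left_le)
    then show ?thesis
      using c(1)[of k] assms(1) by (simp add: field_simps)
  qed
  then show "\<forall>\<^sub>F k in sequentially. (c k - v) / u \<le> a k"
    by simp
  have "(\<lambda>k. (c k - v) / u) \<longlonglongrightarrow> (1 - v) / u"
    using assms(1) by (intro tendsto_intros c) auto
  moreover have "(1 - v) / u = 1"
    using assms(1,3) by (simp add: field_simps)
  ultimately show "(\<lambda>k. (c k - v) / u) \<longlonglongrightarrow> 1"
    by simp
qed (simp add: a)

text \<open>
  A weight equal to 0 gives no information about the operator that it multiplies, but then the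
  scaled displacement vanishes identically; the factor \<open>u\<close> in the conclusion covers this case.
\<close>

lemma class_S_weighted_displacement:
  assumes S: "S \<in> class_S" and T: "T \<in> contractions"
    and uv: "0 \<le> u" "0 \<le> v" "u + v = 1"
    and x: "\<And>k. norm (x k) \<le> 1"
    and lim: "(\<lambda>k. norm (u *\<^sub>R blinfun_apply S (x k) + v *\<^sub>R blinfun_apply T (x k))) \<longlonglongrightarrow> 1"
  shows "(\<lambda>k. u *\<^sub>R (x k - blinfun_apply S (x k))) \<longlonglongrightarrow> 0"
proof (cases "u = 0")
  case False
  have cS: "S \<in> contractions"
    using S by (simp add: class_S_def)
  have le1: "norm (blinfun_apply R (x k)) \<le> 1" if "R \<in> contractions" for R k
    using contractions_norm_apply_le[OF that, of "x k"] x[of k] by linarith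
  have "norm (u *\<^sub>R blinfun_apply S (x k) + v *\<^sub>R blinfun_apply T (x k))
      \<le> u * norm (blinfun_apply S (x k)) + v * norm (blinfun_apply T (x k))" for k
    using norm_triangle_ineq[of "u *\<^sub>R blinfun_apply S (x k)" "v *\<^sub>R blinfun_apply T (x k)"] uv
    by simp
  moreover have "0 < u"
    using uv(1) False by simp
  ultimately have "(\<lambda>k. norm (blinfun_apply S (x k))) \<longlonglongrightarrow> 1"
    by (intro tendsto_1_of_average[OF _ uv(2,3) le1[OF cS] le1[OF T] _ lim])
  then have "(\<lambda>k. x k - blinfun_apply S (x k)) \<longlonglongrightarrow> 0"
    by (rule class_S_D[OF S x])
  then have "(\<lambda>k. u *\<^sub>R (x k - blinfun_apply S (x k))) \<longlonglongrightarrow> u *\<^sub>R 0"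
    by (intro tendsto_scaleR tendsto_const)
  then show ?thesis
    by simp
qed simp

lemma convex_class_S: "convex (class_S :: ('a::complex_banach \<Rightarrow>\<^sub>L 'a) set)"
proof (rule convexI)
  fix S T :: "'a \<Rightarrow>\<^sub>L 'a" and u v :: real
  assume S: "S \<in> class_S" and T: "T \<in> class_S"
    and uv: "0 \<le> u" "0 \<le> v" "u + v = 1"
  have cS: "S \<in> contractions" and cT: "T \<in> contractions"
    using S T by (auto simp: class_S_def)
  have "(\<lambda>k. norm (x k - (u *\<^sub>R blinfun_apply S (x k) + v *\<^sub>R blinfun_apply T (x k)))) \<longlonglongrightarrow> 0"
    if x: "\<And>k. norm (x k) \<le> 1"
      and lim: "(\<lambda>k. norm (u *\<^sub>R blinfun_apply S (x k) + v *\<^sub>R blinfun_apply T (x k))) \<longlonglongrightarrow> 1"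
    for x
  proof -
    have "(\<lambda>k. u *\<^sub>R (x k - blinfun_apply S (x k))) \<longlonglongrightarrow> 0"
      by (rule class_S_weighted_displacement[OF S cT uv x lim])
    moreover have "(\<lambda>k. v *\<^sub>R (x k - blinfun_apply T (x k))) \<longlonglongrightarrow> 0"
      using class_S_weighted_displacement[OF T cS uv(2,1) _ x] lim uv(3)
      by (simp add: add.commute)
    ultimately have "(\<lambda>k. u *\<^sub>R (x k - blinfun_apply S (x k))
        + v *\<^sub>R (x k - blinfun_apply T (x k))) \<longlonglongrightarrow> 0 + 0"
      by (rule tendsto_add)
    moreover have "u *\<^sub>R (x k - blinfun_apply S (x k)) + v *\<^sub>R (x k - blinfun_apply T (x k))
        = x k - (u *\<^sub>R blinfun_apply S (x k) + v *\<^sub>R blinfun_apply T (x k))" for k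
    proof -
      have "u *\<^sub>R x k + v *\<^sub>R x k = x k"
        using uv(3) by (simp flip: scaleR_add_left)
      then show ?thesis
        by (simp add: scaleR_diff_right algebra_simps)
    qed
    ultimately show ?thesis
      by (simp add: tendsto_norm_zero_iff)
  qed
  then show "u *\<^sub>R S + v *\<^sub>R T \<in> class_S"
    using convexD[OF convex_contractions cS cT uv]
    by (simp add: class_S_def blinfun.bilinear_simps)
qed

section \<open>Class (D)\<close>

lemma class_D_compose:
  assumes S: "S \<in> class_D" and T: "T \<in> class_D"
  shows "S o\<^sub>L T \<in> class_D"
proof -
  obtain r s where r: "0 < r" "r < 1" "norm (S - r *\<^sub>R id_blinfun) \<le> 1 - r"
    and s: "0 < s" "s < 1" "norm (T - s *\<^sub>R id_blinfun) \<le> 1 - s"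
    using S T unfolding class_D_def by blast
  have cS: "S \<in> contractions" and cT: "T \<in> contractions"
    using S T by (auto simp: class_D_def)
  have "(S o\<^sub>L T) - (r * s) *\<^sub>R id_blinfun
      = ((S - r *\<^sub>R id_blinfun) o\<^sub>L T) + r *\<^sub>R (T - s *\<^sub>R id_blinfun)"
    by (rule blinfun_eqI) (simp add: blinfun.bilinear_simps algebra_simps)
  also have "norm \<dots> \<le> norm (S - r *\<^sub>R id_blinfun) * norm T + r * norm (T - s *\<^sub>R id_blinfun)"
    using r(1) by (intro norm_triangle_le add_mono norm_blinfun_compose) simp
  also have "\<dots> \<le> (1 - r) * 1 + r * (1 - s)"
    using r s cT by (intro add_mono mult_mono) (auto simp: contractions_def)
  also have "\<dots> = 1 - r * s"
    by (simp add: algebra_simps)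
  finally have "norm ((S o\<^sub>L T) - (r * s) *\<^sub>R id_blinfun) \<le> 1 - r * s" .
  moreover have "0 < r * s" "r * s < 1"
    using r s mult_strict_mono[of r 1 s 1] by auto
  ultimately show ?thesis
    using contractions_compose[OF cS cT] unfolding class_D_def by blast
qed

lemma convex_class_D: "convex (class_D :: ('a::complex_banach \<Rightarrow>\<^sub>L 'a) set)"
proof (rule convexI)
  fix S T :: "'a \<Rightarrow>\<^sub>L 'a" and u v :: real
  assume S: "S \<in> class_D" and T: "T \<in> class_D"
    and uv: "0 \<le> u" "0 \<le> v" "u + v = 1"
  obtain r s where r: "0 < r" "r < 1" "norm (S - r *\<^sub>R id_blinfun) \<le> 1 - r"
    and s: "0 < s" "s < 1" "norm (T - s *\<^sub>R id_blinfun) \<le> 1 - s"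
    using S T unfolding class_D_def by blast
  define t where "t = u * r + v * s"
  have "t \<in> {0<..<1}"
    using convexD[of "{0<..<1::real}" r s u v] r s uv by (simp add: t_def)
  moreover have "norm ((u *\<^sub>R S + v *\<^sub>R T) - t *\<^sub>R id_blinfun) \<le> 1 - t"
  proof -
    have "(u *\<^sub>R S + v *\<^sub>R T) - t *\<^sub>R id_blinfun
        = u *\<^sub>R (S - r *\<^sub>R id_blinfun) + v *\<^sub>R (T - s *\<^sub>R id_blinfun)"
      by (simp add: t_def algebra_simps)
    also have "norm \<dots> \<le> u * norm (S - r *\<^sub>R id_blinfun) + v * norm (T - s *\<^sub>R id_blinfun)"
      using uv by (intro norm_triangle_le) simp
    also have "\<dots> \<le> u * (1 - r) + v * (1 - s)"
      using r s uv by (intro add_mono mult_left_mono) auto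
    also have "\<dots> = (u + v) - t"
      by (simp add: t_def algebra_simps)
    finally show ?thesis
      using uv(3) by simp
  qed
  moreover have "u *\<^sub>R S + v *\<^sub>R T \<in> contractions"
    using S T uv by (intro convexD[OF convex_contractions]) (auto simp: class_D_def)
  ultimately show "u *\<^sub>R S + v *\<^sub>R T \<in> class_D"
    unfolding class_D_def by auto
qed

section \<open>Semigroups and convexity\<close>

theorem theorem3p1:
  shows "multiplicative_semigroup (class_H :: ('a::complex_banach \<Rightarrow>\<^sub>L 'a) set)
    \<and> multiplicative_semigroup (class_S :: ('a \<Rightarrow>\<^sub>L 'a) set)
    \<and> multiplicative_semigroup (class_D :: ('a \<Rightarrow>\<^sub>L 'a) set)
    \<and> convex (class_S :: ('a \<Rightarrow>\<^sub>L 'a) set)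
    \<and> convex (class_D :: ('a \<Rightarrow>\<^sub>L 'a) set)"
  by (simp add: multiplicative_semigroup_def class_H_compose class_S_compose class_D_compose
      convex_class_S convex_class_D)

end
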